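(* Let $t>0$, let $n\ge 1$, let $X_0(1)>X_0(2)>\dots>X_0(n)$ be integers, and fix $0\le k<n$. Let $h^n_k(\ell,z)$, $0\le\ell\le k$, $z\in\mathbb{Z}$, be the unique solution to the initial--boundary value problem for the backwards heat equation $$\begin{cases}(Q^* )^{-1}h^n_k(\ell,z)=h^n_k(\ell+1,z), & \ell<k,\ z\in\mathbb{Z},\\ h^n_k(k,z)=2^{z-X_0(n-k)}, & z\in\mathbb{Z},\\ h^n_k(\ell,X_0(n-\ell))=0, & \ell<k.\end{cases}$$ Then the function $\Phi^n_k$ (defined implicitly in the context by biorthogonality and a polynomial condition) is given by $$\Phi^n_k(z)=(R_t^* )^{-1}h^n_k(0,\cdot)(z)=\sum_{y\in\mathbb{Z}}h^n_k(0,y)\,R_t^{-1}(y,z),\qquad z\in\mathbb{Z}.$$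
   Context: $Q$ is the kernel on $\mathbb{Z}\times\mathbb{Z}$ given by $Q(x,y)=2^{-(x-y)}\mathbf{1}_{x>y}$, and $Q^*(x,y)=Q(y,x)$. Its inverse is the matrix $Q^{-1}(x,y)=2\cdot\mathbf{1}_{x=y-1}-\mathbf{1}_{x=y}$; $(Q^* )^{-1}$ acts on arbitrary sequences $f:\mathbb{Z}\to\mathbb{R}$ by $(Q^* )^{-1}f(z)=2f(z-1)-f(z)$ (on the space of all sequences this has the one-dimensional kernel spanned by $2^z$). For $s\in\mathbb{R}$, $R_s(x,y)=e^{-s}\frac{s^{x-y}}{2^{x-y}(x-y)!}\mathbf{1}_{x\ge y}$; one has $R_t^{-1}=R_{-t}$, and $R_t^*(x,y)=R_t(y,x)$. For $0\le k\le n-1$ set $$\Psi^n_k(x)=\frac1{2\pi \mathrm{i}}\oint_{\Gamma_0}dw\,\frac{(1-w)^k}{2^{x-X_0(n-k)}\,w^{x+k+1-X_0(n-k)}}\,e^{t(w-1)},$$ where $\Gamma_0$ is a positively oriented simple loop enclosing $w=0$ but not $w=1$. The functions $\Phi^n_k:\mathbb{Z}\to\mathbb{R}$, $k=0,\dots,n-1$, are defined implicitly by the two conditions: (1) $\sum_{x\in\mathbb{Z}}\Psi^n_\ell(x)\Phi^n_k(x)=\mathbf{1}_{k=\ell}$ for all $0\le k,\ell\le n-1$; (2) $2^{-x}\Phi^n_k(x)$ is a polynomial of degree at most $n-1$ in $x$ for each $k$. *)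

theory Defs
  imports "HOL-Complex_Analysis.Complex_Analysis"
begin

section \<open>Kernels on \<open>\<int> \<times> \<int>\<close>\<close>

type_synonym kernel = "int \<Rightarrow> int \<Rightarrow> real"

definition adj :: "kernel \<Rightarrow> kernel" where
  "adj K x y = K y x"

definition kapply :: "kernel \<Rightarrow> (int \<Rightarrow> real) \<Rightarrow> int \<Rightarrow> real" where
  "kapply K f z = (\<Sum>\<^sub>\<infinity>y. K z y * f y)"

definition kernel_inverse :: "kernel \<Rightarrow> kernel \<Rightarrow> bool" where
  "kernel_inverse K L \<longleftrightarrow>
     (\<forall>x y. ((\<lambda>z. K x z * L z y) has_sum (if x = y then 1 else 0)) UNIV \<and>
            ((\<lambda>z. L x z * K z y) has_sum (if x = y then 1 else 0)) UNIV)"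

definition Q :: kernel where
  "Q x y = (if x > y then 2 powi (- (x - y)) else 0)"

definition Q_inv :: kernel where
  "Q_inv x y = 2 * of_bool (x = y - 1) - of_bool (x = y)"

definition R :: "real \<Rightarrow> kernel" where
  "R s x y = (if x \<ge> y
     then exp (- s) * (s powi (x - y) / (2 powi (x - y) * fact (nat (x - y)))) else 0)"

definition R_inv :: "real \<Rightarrow> kernel" where
  "R_inv t = R (- t)"

text \<open>The next lemmas justify the names \<open>Q_inv\<close> and \<open>R_inv\<close>, also for the adjoints.\<close>

lemma kernel_inverse_adj: "kernel_inverse K L \<Longrightarrow> kernel_inverse (adj K) (adj L)"
  unfolding kernel_inverse_def adj_def
  by (subst (1 2) mult.commute, subst (1 2) eq_commute) blast

lemma kernel_inverse_Q: "kernel_inverse Q Q_inv"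
  unfolding kernel_inverse_def
proof (intro allI conjI)
  fix x y :: int
  have pw: "2 * (2::real) powi (y - (1 + x)) = 2 powi (y - x)"
    using power_int_add[of "2::real" 1 "y - (1 + x)"] by simp
  have eq: "(2::real) powi (y - x) = 1" if "\<not> y < x" "y < 1 + x"
  proof -
    have "y = x" using that by linarith
    then show ?thesis by simp
  qed
  show "((\<lambda>z. Q x z * Q_inv z y) has_sum (if x = y then 1 else 0)) UNIV"
    by (rule has_sum_finite_neutralI[of "{y - 1, y}"])
       (use pw eq in \<open>auto simp: Q_def Q_inv_def algebra_simps\<close>)
  show "((\<lambda>z. Q_inv x z * Q z y) has_sum (if x = y then 1 else 0)) UNIV"
    by (rule has_sum_finite_neutralI[of "{x + 1, x}"])
       (use pw eq in \<open>auto simp: Q_def Q_inv_def algebra_simps\<close>)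
qed

lemma kapply_adj_Q_inv: "kapply (adj Q_inv) f z = 2 * f (z - 1) - f z"
  unfolding kapply_def adj_def
  by (rule infsumI, rule has_sum_finite_neutralI[of "{z - 1, z}"]) (auto simp: Q_inv_def)

lemma R_has_sum_mult: "((\<lambda>z. R s x z * R u z y) has_sum R (s + u) x y) UNIV"
proof (cases "x \<ge> y")
  case False
  then have "(\<lambda>z. R s x z * R u z y) = (\<lambda>_. 0)"
    by (auto simp: R_def)
  then show ?thesis using False by (simp add: R_def)
next
  case True
  define N where "N = nat (x - y)"
  have x: "x = y + int N" using True by (simp add: N_def)
  have inj: "inj_on (\<lambda>j. y + int j) {..N}" by (auto simp: inj_on_def)
  have "(\<Sum>z\<in>(\<lambda>j. y + int j) ` {..N}. R s x z * R u z y)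
      = (\<Sum>j\<le>N. R s x (y + int j) * R u (y + int j) y)"
    by (simp add: sum.reindex[OF inj])
  also have "\<dots> = (\<Sum>j\<le>N. exp (- (s + u)) / (2 ^ N * fact N)
                      * (of_nat (N choose j) * u ^ j * s ^ (N - j)))"
  proof (rule sum.cong[OF refl])
    fix j assume "j \<in> {..N}"
    then have j: "j \<le> N" by simp
    have e: "x - (y + int j) = int (N - j)" using j by (simp add: x)
    have p2: "(2::real) ^ N = 2 ^ (N - j) * 2 ^ j" using j by (simp flip: power_add)
    have ex: "exp (- (s + u)) = exp (- s) * exp (- u)" by (simp flip: exp_add)
    show "R s x (y + int j) * R u (y + int j) y
        = exp (- (s + u)) / (2 ^ N * fact N) * (of_nat (N choose j) * u ^ j * s ^ (N - j))"
      using j unfolding R_def e binomial_fact[OF j, where 'a = real] p2 ex power_int_of_nat nat_int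
      by (simp add: x) (simp add: field_simps)
  qed
  also have "\<dots> = exp (- (s + u)) / (2 ^ N * fact N) * (u + s) ^ N"
    by (simp only: sum_distrib_left[symmetric] binomial_ring[symmetric])
  also have "\<dots> = R (s + u) x y"
    by (simp add: R_def x add.commute)
  finally have *: "R (s + u) x y = (\<Sum>z\<in>(\<lambda>j. y + int j) ` {..N}. R s x z * R u z y)" ..
  have img: "(\<lambda>j. y + int j) ` {..N} = {y..x}"
  proof
    show "{y..x} \<subseteq> (\<lambda>j. y + int j) ` {..N}"
    proof
      fix z assume "z \<in> {y..x}"
      then show "z \<in> (\<lambda>j. y + int j) ` {..N}"
        by (intro image_eqI[of _ _ "nat (z - y)"]) (auto simp: N_def)
    qed
  qed (auto simp: x)
  show ?thesis
    by (rule has_sum_finite_neutralI[OF _ _ _ *]) (auto simp: img R_def)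
qed

lemma R_0: "R 0 x y = (if x = y then 1 else 0)"
  by (auto simp: R_def power_int_0_left_if)

lemma kernel_inverse_R: "kernel_inverse (R t) (R_inv t)"
  unfolding kernel_inverse_def R_inv_def
  using R_has_sum_mult[of t _ "- t"] R_has_sum_mult[of "- t" _ t] by (simp add: R_0)


section \<open>The functions \<open>\<Psi>\<close> and \<open>\<Phi>\<close>\<close>

definition pos_simple_loop_0_not_1 :: "(real \<Rightarrow> complex) \<Rightarrow> bool" where
  "pos_simple_loop_0_not_1 \<gamma> \<longleftrightarrow>
     valid_path \<gamma> \<and> simple_path \<gamma> \<and> pathfinish \<gamma> = pathstart \<gamma> \<and>
     0 \<in> inside (path_image \<gamma>) \<and> winding_number \<gamma> 0 = 1 \<and>
     1 \<in> outside (path_image \<gamma>)"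

definition Psi ::
  "(real \<Rightarrow> complex) \<Rightarrow> real \<Rightarrow> (nat \<Rightarrow> int) \<Rightarrow> nat \<Rightarrow> nat \<Rightarrow> int \<Rightarrow> complex" where
  "Psi \<gamma> t X0 n k x = 1 / (2 * of_real pi * \<i>) *
     contour_integral \<gamma> (\<lambda>w. (1 - w) ^ k
        / (2 powi (x - X0 (n - k)) * w powi (x + int k + 1 - X0 (n - k)))
        * exp (of_real t * (w - 1)))"

text \<open>The two conditions defining \<open>\<Phi>\<close> constrain only the members with index below \<open>n\<close>.
  The biorthogonality sums over \<open>\<int>\<close> are required to converge (unconditionally).\<close>

definition is_Phi ::
  "(real \<Rightarrow> complex) \<Rightarrow> real \<Rightarrow> (nat \<Rightarrow> int) \<Rightarrow> nat \<Rightarrow> (nat \<Rightarrow> int \<Rightarrow> real) \<Rightarrow> bool" where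
  "is_Phi \<gamma> t X0 n \<Phi> \<longleftrightarrow>
     (\<forall>k<n. \<forall>l<n. ((\<lambda>x. Psi \<gamma> t X0 n l x * of_real (\<Phi> k x)) has_sum
                        (if k = l then 1 else 0)) UNIV) \<and>
     (\<forall>k<n. \<exists>p :: real poly. degree p \<le> n - 1 \<and>
                        (\<forall>x. 2 powi (- x) * \<Phi> k x = poly p (of_int x)))"


section \<open>The backwards heat equation\<close>

text \<open>Only the values \<open>h l z\<close> with \<open>l \<le> k\<close> are constrained.\<close>

definition heat_solution :: "(nat \<Rightarrow> int) \<Rightarrow> nat \<Rightarrow> nat \<Rightarrow> (nat \<Rightarrow> int \<Rightarrow> real) \<Rightarrow> bool" where
  "heat_solution X0 n k h \<longleftrightarrow>
     (\<forall>l<k. \<forall>z. kapply (adj Q_inv) (h l) z = h (l + 1) z) \<and>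
     (\<forall>z. h k z = 2 powi (z - X0 (n - k))) \<and>
     (\<forall>l<k. h l (X0 (n - l)) = 0)"

end

theory Submission
  imports Defs
begin

text \<open>
  Write \<open>D f z = f (z - 1) - f z\<close>. In the form \<open>h l z = 2\<^sup>z * g l z\<close> the heat equation reads
  \<open>g (l + 1) = D (g l)\<close>, so a solution is determined by \<open>g = g 0\<close>, which satisfies
  \<open>D\<^sup>k\<^sup>+\<^sup>1 g = 0\<close> and has prescribed values \<open>(D\<^sup>l g) (X0 (n - l))\<close> for \<open>l \<le> k\<close>; such a \<open>g\<close> exists
  and is unique (interpolation). By residues, pairing \<open>\<Psi>\<^sub>l\<close> with \<open>2\<^sup>x p x\<close>, \<open>p\<close> a polynomial, gives
  \<open>2 powi X0 (n - l)\<close> times the value at \<open>X0 (n - l)\<close> of \<open>D\<^sup>l (A\<^sub>t p)\<close>, where \<open>A\<^sub>t\<close> is averaging over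
  Poisson shifts. This operator acts on polynomials of bounded degree and is invertible with inverse
  \<open>A\<^sub>-\<^sub>t\<close>. Hence biorthogonality is the interpolation problem for \<open>A\<^sub>t p\<close>, whose solution is \<open>g\<close>, and
  \<open>\<Phi>\<^sub>k z = 2\<^sup>z (A\<^sub>-\<^sub>t g) z\<close>, which is the application of \<open>R\<^sub>t\<^sup>-\<^sup>1\<close>.
\<close>

section \<open>Backward differences and their interpolation problem\<close>

definition bdiff :: "(int \<Rightarrow> real) \<Rightarrow> int \<Rightarrow> real" where
  "bdiff f z = f (z - 1) - f z"

text \<open>A coefficient-free form of "polynomial of degree less than \<open>n\<close>" for
  sequences on the integers; for \<open>n = 0\<close> only the zero sequence qualifies.\<close>

definition fdeg_less :: "nat \<Rightarrow> (int \<Rightarrow> real) \<Rightarrow> bool" where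
  "fdeg_less n f \<longleftrightarrow> (bdiff ^^ n) f = (\<lambda>_. 0)"

lemma bdiff_0 [simp]: "bdiff (\<lambda>_. 0) = (\<lambda>_. 0)"
  by (simp add: bdiff_def fun_eq_iff)

lemma funpow_bdiff_0 [simp]: "(bdiff ^^ l) (\<lambda>_. 0) = (\<lambda>_. 0)"
  by (induction l) auto

lemma funpow_bdiff_Suc: "(bdiff ^^ Suc l) f z = (bdiff ^^ l) f (z - 1) - (bdiff ^^ l) f z"
  by (simp add: bdiff_def)

lemma funpow_funpow_bdiff: "(bdiff ^^ i) ((bdiff ^^ j) f) = (bdiff ^^ (j + i)) f"
  by (simp add: funpow_add add.commute[of j])

lemma fdeg_less_mono: "fdeg_less m f \<Longrightarrow> m \<le> n \<Longrightarrow> fdeg_less n f"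
  using funpow_add[of "n - m" m bdiff] by (simp add: fdeg_less_def)

lemma fdeg_less_Suc: "fdeg_less (Suc n) f \<longleftrightarrow> fdeg_less n (bdiff f)"
  by (simp add: fdeg_less_def funpow_Suc_right del: funpow.simps)

lemma bdiff_eq_imp_diff_const:
  assumes "bdiff f = bdiff g"
  shows "f z - g z = f a - g a"
proof -
  have step: "f (z - 1) - g (z - 1) = f z - g z" for z
    using fun_cong[OF assms, of z] by (simp add: bdiff_def)
  show ?thesis
  proof (induction z rule: int_induct[where k = a])
    case (step1 i) then show ?case using step[of "i + 1"] by simp
  next
    case (step2 i) then show ?case using step[of i] by simp
  qed simp
qed

lemma bdiff_surj:
  obtains f where "bdiff f = g" "f a = c"
proof -
  \<comment> \<open>A signed sum of \<open>g\<close> between \<open>a\<close> and \<open>z\<close>;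
    at most one of the two intervals is nonempty, and both are empty at
    \<open>z = a\<close>.\<close>
  define f where "f z = c - (\<Sum>x\<in>{a<..z}. g x) + (\<Sum>x\<in>{z<..a}. g x)" for z
  have "f (z - 1) - f z = g z" for z
  proof (cases "a < z")
    case True
    then have "{a<..z} = insert z {a<..z - 1}" "{z - 1<..a} = {}" "{z<..a} = {}" by auto
    then show ?thesis by (simp add: f_def)
  next
    case False
    then have "{z - 1<..a} = insert z {z<..a}" "{a<..z - 1} = {}" "{a<..z} = {}" by auto
    then show ?thesis by (simp add: f_def)
  qed
  then have "bdiff f = g" by (auto simp: bdiff_def)
  moreover have "f a = c" by (simp add: f_def)
  ultimately show ?thesis using that by blast
qed

text \<open>The problem is triangular: the conditions with \<open>l > 0\<close> form an instance of
  size \<open>n\<close> for \<open>bdiff g\<close>, and the condition at \<open>X 0\<close> then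
  fixes the additive constant of an antidifference.\<close>

lemma bdiff_interpolation_exists:
  "\<exists>g. fdeg_less n g \<and> (\<forall>l<n. (bdiff ^^ l) g (X l) = v l)"
proof (induction n arbitrary: X v)
  case (Suc n)
  obtain f where f: "fdeg_less n f" "\<forall>l<n. (bdiff ^^ l) f (X (Suc l)) = v (Suc l)"
    using Suc[of "X \<circ> Suc" "v \<circ> Suc"] by auto
  obtain g where g: "bdiff g = f" "g (X 0) = v 0" by (rule bdiff_surj)
  have "(bdiff ^^ l) g (X l) = v l" if "l < Suc n" for l
    using that f g by (cases l) (auto simp: funpow_Suc_right simp del: funpow.simps)
  then show ?case using f g by (auto simp: fdeg_less_Suc)
qed (auto simp: fdeg_less_def intro!: exI[of _ "\<lambda>_. 0"])

lemma bdiff_interpolation_unique: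
  assumes "fdeg_less n f" "fdeg_less n g"
    and "\<And>l. l < n \<Longrightarrow> (bdiff ^^ l) f (X l) = (bdiff ^^ l) g (X l)"
  shows "f = g"
  using assms
proof (induction n arbitrary: f g X)
  case (Suc n)
  have eq: "bdiff f = bdiff g"
  proof (rule Suc.IH[of _ _ "X \<circ> Suc"])
    fix l assume "l < n"
    then show "(bdiff ^^ l) (bdiff f) ((X \<circ> Suc) l) = (bdiff ^^ l) (bdiff g) ((X \<circ> Suc) l)"
      using Suc.prems(3)[of "Suc l"] by (simp add: funpow_swap1)
  qed (use Suc.prems in \<open>auto simp: fdeg_less_Suc\<close>)
  have "f z = g z" for z
    using bdiff_eq_imp_diff_const[OF eq, of z "X 0"] Suc.prems(3)[of 0] by simp
  then show ?case by auto
qed (auto simp: fdeg_less_def)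

section \<open>Polynomials as the kernels of iterated differences\<close>

text \<open>Replacing \<open>z\<close> by \<open>z - 1\<close> preserves the leading coefficient,
  which therefore cancels.\<close>

lemma degree_pcompose_shift_diff:
  fixes p :: "real poly"
  assumes "degree p \<le> Suc d"
  shows "degree (pcompose p [:-1, 1:] - p) \<le> d"
proof (rule degree_le, intro allI impI)
  fix i assume "d < i"
  have deg: "degree (pcompose p [:-1, 1:]) = degree p" by (simp add: degree_pcompose)
  show "coeff (pcompose p [:-1, 1:] - p) i = 0"
  proof (cases "i = degree p")
    case True
    then show ?thesis
      using lead_coeff_comp[of "[:-1, 1 :: real:]" p] by (simp add: degree_pcompose)
  next
    case False
    with \<open>d < i\<close> assms have "degree p < i" by simp
    then show ?thesis by (simp add: coeff_eq_0 deg)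
  qed
qed

lemma pcompose_monom: "pcompose (monom a n) q = smult a (q ^ n)" for q :: "'a :: comm_semiring_1 poly"
  by (induction n) (auto simp: monom_0 monom_Suc pcompose_pCons)

lemma poly_antidifference:
  fixes q :: "real poly"
  assumes "degree q \<le> d"
  shows "\<exists>p. degree p \<le> Suc d \<and> pcompose p [:-1, 1:] - p = q"
  using assms
proof (induction d arbitrary: q rule: less_induct)
  case (less d)
  \<comment> \<open>The difference of the monomial of degree \<open>Suc d\<close> has coefficient
    \<open>- real (Suc d)\<close> at \<open>d\<close>, so this scaling reproduces the coefficient of
    \<open>q\<close> there and the remainder \<open>r\<close> drops in degree.\<close>
  define m where "m = monom (- coeff q d / real (Suc d)) (Suc d)"
  define r where "r = q - (pcompose m [:-1, 1:] - m)"
  have degm: "degree m \<le> Suc d" by (simp add: m_def degree_monom_le)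
  have degr: "degree r \<le> d"
    unfolding r_def using degree_pcompose_shift_diff[OF degm] less.prems
    by (intro degree_diff_le[of q]) auto
  have "pcompose m [:-1, 1:] = smult (- coeff q d / real (Suc d)) ([:-1, 1:] ^ Suc d)"
    by (simp only: m_def pcompose_monom)
  moreover have "coeff ([:-1, 1 :: real:] ^ Suc d) d = - real (Suc d)"
    by (subst coeff_linear_poly_power) auto
  ultimately have "coeff r d = coeff q d - coeff q d / real (Suc d) * real (Suc d)"
    by (simp add: r_def m_def del: power_Suc of_nat_Suc)
  then have "coeff r d = 0" by (simp del: of_nat_Suc)
  show ?case
  proof (cases d)
    case 0
    with degr \<open>coeff r d = 0\<close> have "r = 0"
      by (metis le_zero_eq leading_coeff_0_iff)
    then show ?thesis using degm r_def by auto
  next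
    case (Suc d')
    have "degree r \<le> d'"
      using degr \<open>coeff r d = 0\<close> Suc
      by (metis degree_0 le_SucE leading_coeff_0_iff zero_le)
    then obtain p where p: "degree p \<le> Suc d'" "pcompose p [:-1, 1:] - p = r"
      using less.IH[of d' r] Suc by auto
    then show ?thesis
      using degm Suc by (intro exI[of _ "p + m"]) (auto simp: r_def pcompose_add degree_add_le)
  qed
qed

lemma bdiff_poly:
  "bdiff (\<lambda>z. poly p (of_int z)) = (\<lambda>z. poly (pcompose p [:-1, 1:] - p) (of_int z))"
  by (simp add: bdiff_def fun_eq_iff poly_pcompose algebra_simps)

text \<open>Links the polynomial condition on \<Phi> to \<open>fdeg_less\<close>. By induction
  \<open>bdiff f\<close> is polynomial; a polynomial antidifference of it agrees with
  \<open>f\<close> up to a constant.\<close>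

lemma fdeg_less_Suc_iff_poly:
  "fdeg_less (Suc d) f \<longleftrightarrow> (\<exists>p. degree p \<le> d \<and> (\<forall>z. f z = poly p (of_int z)))"
proof (induction d arbitrary: f)
  case 0
  show ?case
  proof
    assume "fdeg_less (Suc 0) f"
    then have "bdiff f = bdiff (\<lambda>_. 0)" by (simp add: fdeg_less_def)
    then have "f z = f 0" for z using bdiff_eq_imp_diff_const[of f "\<lambda>_. 0" z 0] by simp
    then show "\<exists>p. degree p \<le> 0 \<and> (\<forall>z. f z = poly p (of_int z))"
      by (intro exI[of _ "[:f 0:]"]) auto
  next
    assume "\<exists>p. degree p \<le> 0 \<and> (\<forall>z. f z = poly p (of_int z))"
    then obtain c where "\<And>z. f z = c" by (auto elim!: degree_eq_zeroE)
    then show "fdeg_less (Suc 0) f" by (auto simp: fdeg_less_def bdiff_def)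
  qed
next
  case (Suc d)
  show ?case
  proof
    assume "fdeg_less (Suc (Suc d)) f"
    then obtain q where q: "degree q \<le> d" "\<And>z. bdiff f z = poly q (of_int z)"
      using Suc[of "bdiff f"] by (auto simp: fdeg_less_Suc[of "Suc d"])
    obtain p where p: "degree p \<le> Suc d" "pcompose p [:-1, 1:] - p = q"
      using poly_antidifference[OF q(1)] by blast
    have "bdiff f = bdiff (\<lambda>z. poly p (of_int z))"
      using q p by (auto simp: bdiff_poly)
    then have "f z = poly (p + [:f 0 - poly p 0:]) (of_int z)" for z
      using bdiff_eq_imp_diff_const[of f "\<lambda>z. poly p (of_int z)" z 0] by simp
    moreover have "degree (p + [:f 0 - poly p 0:]) \<le> Suc d"
      using p by (intro degree_add_le) auto
    ultimately show "\<exists>p. degree p \<le> Suc d \<and> (\<forall>z. f z = poly p (of_int z))" by blast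
  next
    assume "\<exists>p. degree p \<le> Suc d \<and> (\<forall>z. f z = poly p (of_int z))"
    then obtain p where p: "degree p \<le> Suc d" "f = (\<lambda>z. poly p (of_int z))" by auto
    then show "fdeg_less (Suc (Suc d)) f"
      unfolding fdeg_less_Suc[of "Suc d"] Suc p(2) bdiff_poly
      using degree_pcompose_shift_diff by blast
  qed
qed

section \<open>Poisson averaging of polynomial sequences\<close>

text \<open>Newton's forward formula: with \<open>E\<close> the unit shift,
  \<open>E^j = (1 + (E - 1))^j\<close>, and \<open>E - 1\<close> is minus \<open>E\<close> composed
  with \<open>bdiff\<close>, so the \<open>i\<close>-th forward difference is the signed backward
  one read at \<open>z + int i\<close>.\<close>

lemma newton_backward:
  "f (z + int j) = (\<Sum>i\<le>j. real (j choose i) * ((- 1) ^ i * (bdiff ^^ i) f (z + int i)))"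
proof (induction j arbitrary: z)
  case (Suc j)
  define a where "a i = (- 1) ^ i * (bdiff ^^ i) f (z + int i)" for i
  \<comment> \<open>A forward difference at \<open>z + 1\<close> is the one at \<open>z\<close> plus
    the next order at \<open>z\<close>; Pascal's rule then finishes the induction.\<close>
  have a: "(- 1) ^ i * (bdiff ^^ i) f (z + 1 + int i) = a i + a (Suc i)" for i
  proof -
    have "z + 1 + int i - 1 = z + int i" "z + int (Suc i) = z + 1 + int i" by simp_all
    then show ?thesis
      unfolding a_def funpow_bdiff_Suc by (simp only:) (simp add: algebra_simps)
  qed
  have "f (z + int (Suc j)) = (\<Sum>i\<le>j. real (j choose i) * (a i + a (Suc i)))"
    using Suc[of "z + 1"] unfolding a by (simp add: algebra_simps)
  also have "\<dots> = (\<Sum>i\<le>j. real (j choose i) * a i) + (\<Sum>i\<le>j. real (j choose i) * a (Suc i))"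
    by (simp add: algebra_simps sum.distrib)
  also have "(\<Sum>i\<le>j. real (j choose i) * a i) = (\<Sum>i\<le>Suc j. real (j choose i) * a i)"
    by (simp add: binomial_eq_0)
  also have "\<dots> = a 0 + (\<Sum>i\<le>j. real (j choose Suc i) * a (Suc i))"
    by (subst sum.atMost_Suc_shift) simp
  also have "\<dots> + (\<Sum>i\<le>j. real (j choose i) * a (Suc i))
      = (\<Sum>i\<le>Suc j. real (Suc j choose i) * a i)"
    by (subst sum.atMost_Suc_shift) (simp add: algebra_simps sum.distrib)
  finally show ?case by (simp add: a_def)
qed simp

text \<open>On polynomial sequences of degree less than \<open>n\<close> this is the Poisson average
  \<open>e\<^sup>-\<^sup>s (\<Sum>j. s\<^sup>j / j! * f (z + j))\<close>, that is, the exponential \<open>e\<^sup>s\<^sup>(\<^sup>E\<^sup>-\<^sup>1\<^sup>)\<close> of the shift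
  \<open>E f z = f (z + 1)\<close>, because \<open>E - 1 = - E \<circ> bdiff\<close>.\<close>

definition pexp :: "nat \<Rightarrow> real \<Rightarrow> (int \<Rightarrow> real) \<Rightarrow> int \<Rightarrow> real" where
  "pexp n s f z = (\<Sum>i<n. (- s) ^ i / fact i * (bdiff ^^ i) f (z + int i))"

lemma bdiff_pexp: "bdiff (pexp n s f) = pexp n s (bdiff f)"
proof
  fix z
  have "bdiff (pexp n s f) z = (\<Sum>i<n. (- s) ^ i / fact i * (bdiff ^^ Suc i) f (z + int i))"
    unfolding bdiff_def[of "pexp n s f"] pexp_def funpow_bdiff_Suc
    by (simp add: sum_subtractf[symmetric] right_diff_distrib diff_divide_distrib diff_add_eq)
  then show "bdiff (pexp n s f) z = pexp n s (bdiff f) z"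
    by (simp add: pexp_def funpow_Suc_right del: funpow.simps)
qed

lemma funpow_bdiff_pexp: "(bdiff ^^ l) (pexp n s f) = pexp n s ((bdiff ^^ l) f)"
  by (induction l) (auto simp: bdiff_pexp)

lemma fdeg_less_pexp: "fdeg_less n f \<Longrightarrow> fdeg_less n (pexp m s f)"
  by (simp add: fdeg_less_def funpow_bdiff_pexp) (simp add: pexp_def[abs_def])

lemma pexp_0: "fdeg_less n f \<Longrightarrow> pexp n 0 f = f"
  by (cases n) (auto simp: fun_eq_iff pexp_def fdeg_less_def lessThan_Suc_eq_insert_0 sum.insert
      sum.reindex power_0_left)

text \<open>The law of exponentials via the Cauchy product. Truncation at \<open>n\<close> loses
  nothing, since differences of order at least \<open>n\<close> vanish.\<close>

lemma pexp_pexp: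
  assumes "fdeg_less n f"
  shows "pexp n s (pexp n u f) = pexp n (s + u) f"
proof
  fix z
  define a where "a s i = (- s) ^ i / fact i" for s :: real and i :: nat
  define d where "d i = (bdiff ^^ i) f (z + int i)" for i
  have a: "(\<Sum>i\<le>m. a s i * a u (m - i)) = a (s + u) m" for m
    using exp_series_add_commuting[of "- s" "- u" m]
    by (simp add: a_def scaleR_conv_of_real field_simps)
  have d0: "d m = 0" if "n \<le> m" for m
    using fdeg_less_mono[OF assms that] by (simp add: d_def fdeg_less_def)
  have "pexp n s (pexp n u f) z = (\<Sum>i<n. \<Sum>j<n. a s i * (a u j * d (i + j)))"
    unfolding pexp_def[of n s] funpow_bdiff_pexp unfolding pexp_def
    by (simp add: a_def d_def sum_distrib_left funpow_funpow_bdiff add.assoc)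
  also have "\<dots> = (\<Sum>(i, j)\<in>{..<n} \<times> {..<n}. a s i * (a u j * d (i + j)))"
    by (rule sum.cartesian_product)
  \<comment> \<open>The square is cut to a triangle, summed below along the diagonals
    \<open>i + j = m\<close>.\<close>
  also have "\<dots> = (\<Sum>(i, j)\<in>{(i, j). i + j < n}. a s i * (a u j * d (i + j)))"
    by (rule sum.mono_neutral_right) (auto simp: d0, metis d0 not_less)
  also have "\<dots> = (\<Sum>m<n. \<Sum>i\<le>m. a s i * (a u (m - i) * d m))"
    by (subst sum.triangle_reindex) simp
  also have "\<dots> = pexp n (s + u) f z"
    by (simp add: pexp_def mult.assoc[symmetric] sum_distrib_right[symmetric] a)
       (simp add: a_def d_def)
  finally show "pexp n s (pexp n u f) z = pexp n (s + u) f z" .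
qed

section \<open>Summation against Poisson weights\<close>

text \<open>\<open>pois s l m\<close> is the coefficient of \<open>w\<^sup>m\<close> in \<open>(1 - w)\<^sup>l e\<^sup>s\<^sup>(\<^sup>w\<^sup>-\<^sup>1\<^sup>)\<close>.\<close>

primrec pois :: "real \<Rightarrow> nat \<Rightarrow> int \<Rightarrow> real" where
  "pois s 0 m = (if m \<ge> 0 then exp (- s) * s ^ nat m / fact (nat m) else 0)"
| "pois s (Suc l) m = pois s l m - pois s l (m - 1)"

lemma has_sum_int_shift: "((\<lambda>x. f (x + c)) has_sum S) UNIV \<longleftrightarrow> (f has_sum S) UNIV" for c :: int
  by (rule has_sum_reindex_bij_witness[of _ "\<lambda>x. x - c" "\<lambda>x. x + c"]) auto

lemma has_sum_finite_sum:
  fixes f :: "'a \<Rightarrow> 'b \<Rightarrow> real"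
  assumes "finite I" "\<And>i. i \<in> I \<Longrightarrow> (f i has_sum S i) A"
  shows "((\<lambda>x. \<Sum>i\<in>I. f i x) has_sum (\<Sum>i\<in>I. S i)) A"
  using assms by (induction I rule: finite_induct) (auto intro: has_sum_add)

lemma has_sum_iff_eq:
  fixes a b :: "'a :: {topological_comm_monoid_add, t2_space}"
  shows "(f has_sum a) A \<Longrightarrow> (f has_sum b) A \<longleftrightarrow> a = b"
  using has_sum_unique by blast

lemma has_sum_exp_real: "((\<lambda>j. s ^ j / fact j) has_sum exp s) UNIV" for s :: real
proof (rule norm_summable_imp_has_sum)
  show "summable (\<lambda>j. norm (s ^ j / fact j))"
    using summable_norm_exp[of s] by (simp add: field_simps)
  show "(\<lambda>j. s ^ j / fact j) sums exp s"
    using exp_converges[of s] by (simp add: field_simps)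
qed

text \<open>Up to the factor \<open>exp s\<close> these are the binomial moments of the Poisson law:
  for \<open>j >= i\<close> the term is \<open>s ^ i / fact i\<close> times the exponential term of
  index \<open>j - i\<close>.\<close>

lemma has_sum_exp_binomial:
  "((\<lambda>j. s ^ j / fact j * real (j choose i)) has_sum (exp s * (s ^ i / fact i))) UNIV" for s :: real
proof -
  have "((\<lambda>j. s ^ j / fact j * (s ^ i / fact i)) has_sum (exp s * (s ^ i / fact i))) UNIV"
    by (intro has_sum_cmult_left has_sum_exp_real)
  also have "(\<lambda>j. s ^ j / fact j * (s ^ i / fact i))
      = (\<lambda>j. s ^ j / fact j * real (j choose i)) \<circ> (\<lambda>j. j + i)"
    by (simp add: binomial_fact power_add fun_eq_iff)
  finally have "((\<lambda>j. s ^ j / fact j * real (j choose i)) has_sum (exp s * (s ^ i / fact i)))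
      (range (\<lambda>j. j + i))"
    by (subst has_sum_reindex) (simp_all add: o_def)
  then show ?thesis
  proof (rule has_sum_cong_neutral[THEN iffD1, rotated -1])
    fix j assume "j \<in> UNIV - range (\<lambda>j. j + i)"
    then have "j < i" by (metis DiffD2 le_add_diff_inverse2 linorder_not_le rangeI)
    then show "s ^ j / fact j * real (j choose i) = 0" by simp
  qed auto
qed

text \<open>Newton's formula writes \<open>f\<close> as a finite combination of binomial
  coefficients, whose moments are known. Negative \<open>s\<close> is included; \<open>- t\<close>
  serves for the inverse of \<open>R\<close>.\<close>

lemma has_sum_pexp:
  assumes "fdeg_less n f"
  shows "((\<lambda>m. pois s 0 m * f (z + m)) has_sum pexp n s f z) UNIV"
proof -
  define a where "a i = (- 1) ^ i * (bdiff ^^ i) f (z + int i)" for i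
  have a0: "a i = 0" if "n \<le> i" for i
    using fdeg_less_mono[OF assms that] by (simp add: a_def fdeg_less_def)
  have f: "f (z + int j) = (\<Sum>i<n. real (j choose i) * a i)" for j
  proof -
    have "f (z + int j) = (\<Sum>i\<le>j. real (j choose i) * a i)"
      unfolding a_def by (rule newton_backward)
    \<comment> \<open>Indices \<open>i >= n\<close> drop out because \<open>a i = 0\<close>, indices
      \<open>i > j\<close> because the binomial coefficient is 0.\<close>
    also have "\<dots> = (\<Sum>i\<in>{..j} \<inter> {..<n}. real (j choose i) * a i)"
      by (rule sum.mono_neutral_right) (use a0 in \<open>auto simp: not_less[symmetric]\<close>)
    also have "\<dots> = (\<Sum>i<n. real (j choose i) * a i)"
      by (rule sum.mono_neutral_left) auto
    finally show ?thesis .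
  qed
  have "((\<lambda>j. \<Sum>i<n. s ^ j / fact j * real (j choose i) * (exp (- s) * a i)) has_sum
      (\<Sum>i<n. exp s * (s ^ i / fact i) * (exp (- s) * a i))) UNIV"
    by (intro has_sum_finite_sum has_sum_cmult_left has_sum_exp_binomial) auto
  also have "(\<Sum>i<n. exp s * (s ^ i / fact i) * (exp (- s) * a i)) = pexp n s f z"
    unfolding pexp_def
    by (rule sum.cong) (auto simp: a_def exp_minus power_minus[of s])
  also have "(\<lambda>j. \<Sum>i<n. s ^ j / fact j * real (j choose i) * (exp (- s) * a i))
      = (\<lambda>m. pois s 0 m * f (z + m)) \<circ> int"
    by (simp add: f fun_eq_iff sum_distrib_left mult_ac)
  finally have "((\<lambda>m. pois s 0 m * f (z + m)) has_sum pexp n s f z) (range int)"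
    by (subst has_sum_reindex) (simp_all add: o_def)
  then show ?thesis
  proof (rule has_sum_cong_neutral[THEN iffD1, rotated -1])
    fix m assume "m \<in> UNIV - range int"
    then have "m < 0" by (metis DiffD2 linorder_not_le rangeI zero_le_imp_eq_int)
    then show "pois s 0 m * f (z + m) = 0" by simp
  qed auto
qed

text \<open>Summation by parts: each factor \<open>1 - w\<close> differences the weights, and the
  difference passes to the average of \<open>f\<close>. The base point \<open>x - int l\<close>
  moves left once per difference.\<close>

lemma has_sum_pois:
  assumes "fdeg_less n f"
  shows "((\<lambda>m. pois s l m * f (x - int l + m)) has_sum (bdiff ^^ l) (pexp n s f) x) UNIV"
proof (induction l arbitrary: x)
  case 0
  then show ?case using has_sum_pexp[OF assms] by simp
next
  case (Suc l)
  have "((\<lambda>m. pois s l (m - 1) * f (x - int l + (m - 1))) has_sum (bdiff ^^ l) (pexp n s f) x) UNIV"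
    using has_sum_int_shift[of "\<lambda>m. pois s l m * f (x - int l + m)" "- 1"] Suc[of x] by simp
  from has_sum_add[OF Suc[of "x - 1"] has_sum_uminusI[OF this]]
  have "((\<lambda>m. pois s l m * f (x - 1 - int l + m) - pois s l (m - 1) * f (x - int l + (m - 1)))
      has_sum (bdiff ^^ Suc l) (pexp n s f) x) UNIV"
    by (simp only: funpow_bdiff_Suc diff_conv_add_uminus)
  also have "(\<lambda>m. pois s l m * f (x - 1 - int l + m) - pois s l (m - 1) * f (x - int l + (m - 1)))
      = (\<lambda>m. pois s (Suc l) m * f (x - int (Suc l) + m))"
    by (auto simp: fun_eq_iff algebra_simps)
  finally show ?case .
qed

section \<open>Residues, and the action of \<Psi> and the inverse of \<open>R\<close>\<close>

lemma higher_deriv_exp_affine: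
  fixes c :: complex
  shows "(deriv ^^ j) (\<lambda>w. exp (c * (w - 1))) = (\<lambda>w. c ^ j * exp (c * (w - 1)))"
proof (induction j)
  case (Suc j)
  have "((\<lambda>w. c ^ j * exp (c * (w - 1))) has_field_derivative c ^ Suc j * exp (c * (w - 1))) (at w)" for w
    by (auto intro!: derivative_eq_intros)
  then show ?case by (auto simp: Suc fun_eq_iff intro!: DERIV_imp_deriv)
qed simp

text \<open>Coefficient extraction at 0. For \<open>l = 0\<close> a residue gives the exponential
  coefficient, or Cauchy's theorem gives 0 when \<open>m < 0\<close>; each further factor
  \<open>1 - w\<close> follows the recursion of \<open>pois\<close>.\<close>

lemma has_contour_integral_pois:
  assumes \<gamma>: "valid_path \<gamma>" "pathfinish \<gamma> = pathstart \<gamma>" "0 \<notin> path_image \<gamma>" "winding_number \<gamma> 0 = 1"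
  shows "((\<lambda>w. (1 - w) ^ l / w powi (m + 1) * exp (of_real t * (w - 1)))
    has_contour_integral (2 * of_real pi * \<i> * of_real (pois t l m))) \<gamma>"
proof (induction l arbitrary: m)
  case 0
  define E where "E w = exp (of_real t * (w - 1))" for w :: complex
  have hol: "E holomorphic_on A" for A
    unfolding E_def by (intro holomorphic_intros)
  show ?case
  proof (cases "m \<ge> 0")
    case True
    define N where "N = nat m"
    have m: "m = int N" using True by (simp add: N_def)
    define F where "F w = E w / w ^ Suc N" for w
    have holF: "F holomorphic_on UNIV - {0}"
      unfolding F_def by (intro holomorphic_intros hol) auto
    have img: "path_image \<gamma> \<subseteq> UNIV - {0}" using \<gamma> by auto
    have "contour_integral \<gamma> F = 2 * pi * \<i> * (\<Sum>p\<in>{0}. winding_number \<gamma> p * residue F p)"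
      by (rule Residue_theorem[of UNIV]) (use \<gamma> holF img in auto)
    moreover have "residue F 0 = (deriv ^^ N) E 0 / fact N"
      unfolding F_def by (rule residue_holomorphic_over_power'[OF _ _ hol[of UNIV]]) auto
    moreover have "(deriv ^^ N) E 0 = of_real (t ^ N * exp (- t))"
      by (simp add: E_def[abs_def] higher_deriv_exp_affine exp_of_real[symmetric])
    ultimately have "contour_integral \<gamma> F = 2 * of_real pi * \<i> * of_real (pois t 0 m)"
      using \<gamma> by (simp add: m mult.commute)
    moreover have "F contour_integrable_on \<gamma>"
      using contour_integrable_holomorphic_simple[OF holF] \<gamma> img by auto
    ultimately have "(F has_contour_integral 2 * of_real pi * \<i> * of_real (pois t 0 m)) \<gamma>"
      by (metis has_contour_integral_integral)
    moreover have "w powi (m + 1) = w ^ Suc N" for w :: complex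
      using power_int_of_nat[of w "Suc N"] by (simp add: m add.commute)
    ultimately show ?thesis by (simp add: F_def[abs_def] E_def del: pois.simps power_Suc)
  next
    case False
    define F where "F w = w ^ nat (- m - 1) * E w" for w
    have "(F has_contour_integral 0) \<gamma>"
      unfolding F_def using \<gamma>
      by (intro Cauchy_theorem_convex_simple[of _ UNIV] holomorphic_intros hol) auto
    \<comment> \<open>Also true at \<open>w = 0\<close>: both sides are 1 for
      \<open>m = - 1\<close>, and 0 for smaller \<open>m\<close> by the convention for division by
      zero.\<close>
    moreover have "1 / w powi (m + 1) = w ^ nat (- m - 1)" for w :: complex
      using False power_int_minus_divide[of w "- m - 1"]
      by (cases "w = 0") (auto simp: power_int_def field_simps)
    ultimately show ?thesis using False by (simp add: F_def[abs_def] E_def)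
  qed
next
  case (Suc l)
  show ?case
  proof (rule has_contour_integral_eq)
    show "((\<lambda>w. (1 - w) ^ l / w powi (m + 1) * exp (of_real t * (w - 1))
        - (1 - w) ^ l / w powi (m - 1 + 1) * exp (of_real t * (w - 1))) has_contour_integral
        (2 * of_real pi * \<i> * of_real (pois t (Suc l) m))) \<gamma>"
      using has_contour_integral_diff[OF Suc[of m] Suc[of "m - 1"]] by (simp add: algebra_simps)
    fix w assume "w \<in> path_image \<gamma>"
    then have "w \<noteq> 0" using \<gamma> by auto
    then show "(1 - w) ^ l / w powi (m + 1) * exp (of_real t * (w - 1))
        - (1 - w) ^ l / w powi (m - 1 + 1) * exp (of_real t * (w - 1))
        = (1 - w) ^ Suc l / w powi (m + 1) * exp (of_real t * (w - 1))"
      by (simp add: power_int_add field_simps)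
  qed
qed

lemma Psi_eq_pois:
  assumes "pos_simple_loop_0_not_1 \<gamma>"
  shows "Psi \<gamma> t X0 n l x
    = of_real (2 powi (X0 (n - l) - x) * pois t l (x + int l - X0 (n - l)))"
proof -
  define X where "X = X0 (n - l)"
  have \<gamma>: "valid_path \<gamma>" "pathfinish \<gamma> = pathstart \<gamma>" "0 \<notin> path_image \<gamma>" "winding_number \<gamma> 0 = 1"
    using assms by (auto simp: pos_simple_loop_0_not_1_def inside_def)
  have "x + int l + 1 - X = x + int l - X + 1" by simp
  note power = arg_cong[OF this, of "\<lambda>a. w powi a" for w :: complex]
  have "(\<lambda>w :: complex. (1 - w) ^ l / (2 powi (x - X) * w powi (x + int l + 1 - X)) * exp (of_real t * (w - 1)))
      = (\<lambda>w. 1 / 2 powi (x - X) * ((1 - w) ^ l / w powi (x + int l - X + 1) * exp (of_real t * (w - 1))))"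
    by (simp add: fun_eq_iff power)
  with has_contour_integral_lmul[OF has_contour_integral_pois[OF \<gamma>, of l "x + int l - X" t],
      of "1 / 2 powi (x - X)"]
  have "contour_integral \<gamma> (\<lambda>w. (1 - w) ^ l / (2 powi (x - X) * w powi (x + int l + 1 - X))
      * exp (of_real t * (w - 1)))
      = 1 / 2 powi (x - X) * (2 * of_real pi * \<i> * of_real (pois t l (x + int l - X)))"
    by (simp add: contour_integral_unique)
  then show ?thesis
    using power_int_minus_divide[of "2 :: complex" "x - X"]
    by (simp add: Psi_def flip: X_def)
qed

text \<open>The factor \<open>2 powi x\<close> cancels the one in \<open>Psi\<close>; shifting the
  index by \<open>int l - X0 (n - l)\<close> leaves \<open>has_sum_pois\<close> at the point
  \<open>X0 (n - l)\<close>.\<close>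

lemma has_sum_Psi:
  assumes "pos_simple_loop_0_not_1 \<gamma>" "fdeg_less m f"
  shows "((\<lambda>x. Psi \<gamma> t X0 n l x * of_real (2 powi x * f x)) has_sum
    of_real (2 powi X0 (n - l) * (bdiff ^^ l) (pexp m t f) (X0 (n - l)))) UNIV"
proof -
  define X where "X = X0 (n - l)"
  have "((\<lambda>x. pois t l (x + int l - X) * f x) has_sum (bdiff ^^ l) (pexp m t f) X) UNIV"
    using has_sum_pois[OF assms(2), of t l X]
      has_sum_int_shift[of "\<lambda>m. pois t l m * f (X - int l + m)" "int l - X"]
    by (simp add: add_diff_eq)
  from has_sum_cmult_right[OF this, of "2 powi X"]
  have "((\<lambda>x. complex_of_real (2 powi X * (pois t l (x + int l - X) * f x))) has_sum
      of_real (2 powi X * (bdiff ^^ l) (pexp m t f) X)) UNIV"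
    by (rule has_sum_of_real_iff[THEN iffD2])
  also have "(\<lambda>x. complex_of_real (2 powi X * (pois t l (x + int l - X) * f x)))
      = (\<lambda>x. Psi \<gamma> t X0 n l x * of_real (2 powi x * f x))"
    unfolding Psi_eq_pois[OF assms(1)]
    by (auto simp: fun_eq_iff power_int_diff simp flip: X_def)
  finally show ?thesis by (simp add: X_def)
qed

lemma R_inv_eq_pois: "R_inv t y z = 2 powi (z - y) * pois (- t) 0 (y - z)"
  using power_int_minus_divide[of "2 :: real" "y - z"]
  by (auto simp: R_inv_def R_def power_int_def)

text \<open>Conjugation by powers of 2 turns the adjoint of \<open>R_inv t\<close> into Poisson
  averaging with parameter \<open>- t\<close>.\<close>

lemma has_sum_R_inv:
  assumes "fdeg_less m g"
  shows "((\<lambda>y. 2 powi y * g y * R_inv t y z) has_sum 2 powi z * pexp m (- t) g z) UNIV"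
proof -
  have "((\<lambda>y. pois (- t) 0 (y - z) * g y) has_sum pexp m (- t) g z) UNIV"
    using has_sum_pexp[OF assms, of "- t" z]
      has_sum_int_shift[of "\<lambda>m. pois (- t) 0 m * g (z + m)" "- z"]
    by (simp del: pois.simps)
  from has_sum_cmult_right[OF this, of "2 powi z"]
  show ?thesis
    unfolding R_inv_eq_pois
    by (simp add: power_int_diff mult_ac del: pois.simps)
qed

section \<open>Characterization of both problems by the same data\<close>

text \<open>For \<open>k < m\<close> the functions with this property do not depend on \<open>m\<close>: the case \<open>m = k + 1\<close>
  describes the heat equation, the case \<open>m = n\<close> the biorthogonality conditions.\<close>

definition dual_data :: "(nat \<Rightarrow> int) \<Rightarrow> nat \<Rightarrow> nat \<Rightarrow> nat \<Rightarrow> (int \<Rightarrow> real) \<Rightarrow> bool" where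
  "dual_data X0 n k m g \<longleftrightarrow> fdeg_less m g \<and>
     (\<forall>l<m. (bdiff ^^ l) g (X0 (n - l)) = (if l = k then 2 powi (- X0 (n - k)) else 0))"

lemma dual_data_exists: "\<exists>g. dual_data X0 n k m g"
  unfolding dual_data_def by (rule bdiff_interpolation_exists)

lemma dual_data_unique:
  "dual_data X0 n k m f \<Longrightarrow> dual_data X0 n k m g \<Longrightarrow> f = g"
  unfolding dual_data_def
  by (rule bdiff_interpolation_unique[of m _ _ "\<lambda>l. X0 (n - l)"]) auto

text \<open>The added conditions ask for the value 0 of differences of order above \<open>k\<close>,
  which the degree bound annihilates.\<close>

lemma dual_data_extend:
  assumes "dual_data X0 n k (Suc k) g" "k < m"
  shows "dual_data X0 n k m g"
proof -
  have deg: "fdeg_less l g" if "k < l" for l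
    using assms that by (auto simp: dual_data_def intro: fdeg_less_mono)
  have "(bdiff ^^ l) g (X0 (n - l)) = (if l = k then 2 powi (- X0 (n - k)) else 0)" for l
  proof (cases "l \<le> k")
    case False
    then show ?thesis using deg[of l] by (simp add: fdeg_less_def)
  qed (use assms in \<open>auto simp: dual_data_def\<close>)
  then show ?thesis using deg assms by (auto simp: dual_data_def)
qed

text \<open>Dividing by \<open>2 powi z\<close> turns the adjoint of \<open>Q_inv\<close> into
  \<open>bdiff\<close>. The terminal condition says that the \<open>k\<close>-th difference is a
  given constant: a degree bound plus one value at \<open>X0 (n - k)\<close>.\<close>

lemma heat_solution_iff:
  "heat_solution X0 n k h \<longleftrightarrow>
    (\<exists>g. dual_data X0 n k (Suc k) g \<and> (\<forall>l\<le>k. \<forall>z. h l z = 2 powi z * (bdiff ^^ l) g z))"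
proof
  assume h: "heat_solution X0 n k h"
  define g where "g l z = 2 powi (- z) * h l z" for l z
  have hg: "h l z = 2 powi z * g l z" for l z
    by (simp add: g_def power_int_minus)
  have step: "bdiff (g l) = g (Suc l)" if "l < k" for l
  proof
    fix z
    have "h (Suc l) z = 2 * h l (z - 1) - h l z"
      using h that by (auto simp: heat_solution_def kapply_adj_Q_inv)
    then show "bdiff (g l) z = g (Suc l) z"
      by (simp add: hg bdiff_def power_int_diff right_diff_distrib[symmetric])
  qed
  have iter: "(bdiff ^^ l) (g 0) = g l" if "l \<le> k" for l
    using that by (induction l) (auto simp: step)
  have gk: "g k z = 2 powi (- X0 (n - k))" for z
    using h by (simp add: g_def heat_solution_def flip: power_int_add)
  have "g l (X0 (n - l)) = 0" if "l < k" for l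
    using h that by (simp add: heat_solution_def g_def)
  then have "dual_data X0 n k (Suc k) (g 0)"
    by (auto simp: dual_data_def fdeg_less_def iter gk fun_eq_iff bdiff_def less_Suc_eq_le)
  then show "\<exists>g. dual_data X0 n k (Suc k) g \<and> (\<forall>l\<le>k. \<forall>z. h l z = 2 powi z * (bdiff ^^ l) g z)"
    using hg iter by auto
next
  assume "\<exists>g. dual_data X0 n k (Suc k) g \<and> (\<forall>l\<le>k. \<forall>z. h l z = 2 powi z * (bdiff ^^ l) g z)"
  then obtain g where g: "dual_data X0 n k (Suc k) g"
    and h: "\<And>l z. l \<le> k \<Longrightarrow> h l z = 2 powi z * (bdiff ^^ l) g z" by blast
  have "bdiff ((bdiff ^^ k) g) = bdiff (\<lambda>_. 0)"
    using g by (simp add: dual_data_def fdeg_less_def)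
  then have "(bdiff ^^ k) g z = (bdiff ^^ k) g (X0 (n - k))" for z
    using bdiff_eq_imp_diff_const[of "(bdiff ^^ k) g" "\<lambda>_. 0"] by simp
  then have "(bdiff ^^ k) g z = 2 powi (- X0 (n - k))" for z
    using g by (simp add: dual_data_def)
  then show "heat_solution X0 n k h"
    using g
    by (auto simp: heat_solution_def kapply_adj_Q_inv h dual_data_def bdiff_def power_int_diff
        power_int_minus field_simps)
qed

text \<open>Under the degree bound, biorthogonality states that the Poisson average of
  \<open>2 powi (- x) * \<Phi> k x\<close> solves the interpolation problem; averaging with
  \<open>- t\<close> undoes the average.\<close>

lemma is_Phi_iff:
  assumes "pos_simple_loop_0_not_1 \<gamma>" "n \<ge> 1"
  shows "is_Phi \<gamma> t X0 n \<Phi> \<longleftrightarrow>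
    (\<forall>k<n. \<exists>g. dual_data X0 n k n g \<and> (\<forall>z. \<Phi> k z = 2 powi z * pexp n (- t) g z))"
proof -
  have poly: "(\<exists>p. degree p \<le> n - 1 \<and> (\<forall>x. 2 powi (- x) * \<phi> x = poly p (of_int x)))
      \<longleftrightarrow> fdeg_less n (\<lambda>x. 2 powi (- x) * \<phi> x)" for \<phi>
    using fdeg_less_Suc_iff_poly[of "n - 1"] assms by simp
  \<comment> \<open>The degree bound already gives convergence to a known sum, so only an equation
    between values remains.\<close>
  have sum: "((\<lambda>x. Psi \<gamma> t X0 n l x * of_real (\<phi> x)) has_sum (if k = l then 1 else 0)) UNIV \<longleftrightarrow>
      (bdiff ^^ l) (pexp n t (\<lambda>x. 2 powi (- x) * \<phi> x)) (X0 (n - l))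
        = (if l = k then 2 powi (- X0 (n - k)) else 0)" (is "?L \<longleftrightarrow> ?d = _")
    if "fdeg_less n (\<lambda>x. 2 powi (- x) * \<phi> x)" for \<phi> k l
  proof -
    have eq: "2 powi x * (2 powi (- x) * \<phi> x) = \<phi> x" for x by (simp add: power_int_minus)
    have "?L \<longleftrightarrow> complex_of_real (2 powi X0 (n - l) * ?d) = (if k = l then 1 else 0)"
      by (rule has_sum_iff_eq[OF has_sum_Psi[OF assms(1) that, of t X0 n l, unfolded eq]])
    also have "\<dots> \<longleftrightarrow> complex_of_real (2 powi X0 (n - l) * ?d) = of_real (if k = l then 1 else 0)"
      by (simp only: of_real_1 of_real_0 if_distrib[of of_real])
    also have "\<dots> \<longleftrightarrow> 2 powi X0 (n - l) * ?d = (if k = l then 1 else 0)"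
      by (rule of_real_eq_iff)
    also have "\<dots> \<longleftrightarrow> ?d = (if l = k then 2 powi (- X0 (n - k)) else 0)"
      by (auto simp: power_int_minus field_simps)
    finally show ?thesis .
  qed
  have "((\<forall>l<n. ((\<lambda>x. Psi \<gamma> t X0 n l x * of_real (\<phi> x)) has_sum (if k = l then 1 else 0)) UNIV) \<and>
      fdeg_less n (\<lambda>x. 2 powi (- x) * \<phi> x)) \<longleftrightarrow>
      (\<exists>g. dual_data X0 n k n g \<and> (\<forall>z. \<phi> z = 2 powi z * pexp n (- t) g z))" (is "?L \<longleftrightarrow> ?R") for \<phi> k
  proof
    assume L: ?L
    define f where "f x = 2 powi (- x) * \<phi> x" for x
    have deg: "fdeg_less n f" using L by (simp add: f_def[abs_def])
    have "dual_data X0 n k n (pexp n t f)"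
      using L sum[of \<phi> _ k, folded f_def] fdeg_less_pexp[OF deg, of n t]
      by (simp add: dual_data_def f_def[symmetric])
    moreover have "pexp n (- t) (pexp n t f) = f"
      using pexp_pexp[OF deg, of "- t" t] pexp_0[OF deg] by simp
    moreover have "\<phi> z = 2 powi z * f z" for z by (simp add: f_def power_int_minus)
    ultimately show ?R by (intro exI[of _ "pexp n t f"]) simp
  next
    assume ?R
    then obtain g where g: "dual_data X0 n k n g" "\<And>z. \<phi> z = 2 powi z * pexp n (- t) g z" by blast
    have deg: "fdeg_less n g" using g by (simp add: dual_data_def)
    have \<phi>: "(\<lambda>x. 2 powi (- x) * \<phi> x) = pexp n (- t) g" by (auto simp: g power_int_minus)
    have "pexp n t (pexp n (- t) g) = g"
      using pexp_pexp[OF deg, of t "- t"] pexp_0[OF deg] by simp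
    then show ?L
      using sum[of \<phi>, unfolded \<phi>, OF fdeg_less_pexp[OF deg]] fdeg_less_pexp[OF deg] g(1)
      unfolding \<phi> by (auto simp: dual_data_def)
  qed
  then show ?thesis unfolding is_Phi_def poly by blast
qed

theorem theorem2p2:
  fixes t :: real and n k :: nat and X0 :: "nat \<Rightarrow> int" and \<gamma> :: "real \<Rightarrow> complex"
  assumes "t > 0" and "n \<ge> 1"
    and "\<And>i j. 1 \<le> i \<Longrightarrow> i < j \<Longrightarrow> j \<le> n \<Longrightarrow> X0 i > X0 j"
    and "k < n"
    and "pos_simple_loop_0_not_1 \<gamma>"
  shows
    "(\<exists>h. heat_solution X0 n k h \<and>
          (\<forall>h'. heat_solution X0 n k h' \<longrightarrow> (\<forall>l\<le>k. \<forall>z. h' l z = h l z))) \<and>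
     (\<exists>\<Phi>. is_Phi \<gamma> t X0 n \<Phi> \<and>
          (\<forall>\<Phi>'. is_Phi \<gamma> t X0 n \<Phi>' \<longrightarrow> (\<forall>j<n. \<forall>z. \<Phi>' j z = \<Phi> j z))) \<and>
     (\<forall>h \<Phi>. heat_solution X0 n k h \<longrightarrow> is_Phi \<gamma> t X0 n \<Phi> \<longrightarrow>
        (\<forall>z. \<Phi> k z = kapply (adj (R_inv t)) (h 0) z \<and>
             ((\<lambda>y. h 0 y * R_inv t y z) has_sum \<Phi> k z) UNIV))"
proof (intro conjI allI impI)
  obtain g where g: "dual_data X0 n k (Suc k) g" using dual_data_exists by blast
  show "\<exists>h. heat_solution X0 n k h \<and>
          (\<forall>h'. heat_solution X0 n k h' \<longrightarrow> (\<forall>l\<le>k. \<forall>z. h' l z = h l z))"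
  proof (intro exI conjI allI impI)
    show "heat_solution X0 n k (\<lambda>l z. 2 powi z * (bdiff ^^ l) g z)"
      using g by (auto simp: heat_solution_iff)
    fix h' l z assume "heat_solution X0 n k h'" "l \<le> k"
    then show "h' l z = 2 powi z * (bdiff ^^ l) g z"
      using dual_data_unique[OF g] by (metis heat_solution_iff)
  qed
  obtain G where G: "\<And>j. dual_data X0 n j n (G j)"
    using dual_data_exists[of X0 n _ n] by metis
  show "\<exists>\<Phi>. is_Phi \<gamma> t X0 n \<Phi> \<and>
          (\<forall>\<Phi>'. is_Phi \<gamma> t X0 n \<Phi>' \<longrightarrow> (\<forall>j<n. \<forall>z. \<Phi>' j z = \<Phi> j z))"
  proof (intro exI conjI allI impI)
    show "is_Phi \<gamma> t X0 n (\<lambda>j z. 2 powi z * pexp n (- t) (G j) z)"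
      using G by (auto simp: is_Phi_iff[OF assms(5,2)])
    fix \<Phi>' j z assume "is_Phi \<gamma> t X0 n \<Phi>'" "j < n"
    then show "\<Phi>' j z = 2 powi z * pexp n (- t) (G j) z"
      using dual_data_unique[OF G] by (metis is_Phi_iff[OF assms(5,2)])
  qed
  fix h \<Phi> z assume h: "heat_solution X0 n k h" and \<Phi>: "is_Phi \<gamma> t X0 n \<Phi>"
  obtain f where f: "dual_data X0 n k (Suc k) f" "\<And>z. h 0 z = 2 powi z * f z"
    using h by (auto simp: heat_solution_iff)
  \<comment> \<open>One sequence \<open>f\<close> now describes both \<open>h\<close> and
    \<open>\<Phi> k\<close>.\<close>
  have fn: "dual_data X0 n k n f" by (rule dual_data_extend[OF f(1) \<open>k < n\<close>])
  have "\<Phi> k z = 2 powi z * pexp n (- t) f z"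
    using \<Phi> \<open>k < n\<close> dual_data_unique[OF fn] by (metis is_Phi_iff[OF assms(5,2)])
  then show sum: "((\<lambda>y. h 0 y * R_inv t y z) has_sum \<Phi> k z) UNIV"
    using has_sum_R_inv[of n f t z] fn by (simp add: f dual_data_def)
  show "\<Phi> k z = kapply (adj (R_inv t)) (h 0) z"
    using infsumI[OF sum] by (simp add: kapply_def adj_def mult.commute)
qed

end
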